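(* Let $\mathcal{E}=\{e_1,\dots,e_{n_e}\}$ be a finite nonempty set of entities and $\mathcal{R}=\{r_1,\dots,r_{n_r}\}$ a finite nonempty set of relations, and let $\mathcal{T}\subseteq \mathcal{E}\times\mathcal{R}\times\mathcal{E}$ be any ground truth (set of correct triples). Put $d_e=|\mathcal{E}|=n_e$, $d_r=|\mathcal{R}|=n_r$ and $k=\min(d_e,d_r)$. Then there exists an assignment of values to the parameters of the LowFER model with entity embedding dimension $d_e$, relation embedding dimension $d_r$ and factorization rank $k$, namely entity embeddings $\mathbf{e}_1,\dots,\mathbf{e}_{n_e}\in\mathbb{R}^{d_e}$, relation embeddings $\mathbf{r}_1,\dots,\mathbf{r}_{n_r}\in\mathbb{R}^{d_r}$, and matrices $\mathbf{U}\in\mathbb{R}^{d_e\times kd_e}$, $\mathbf{V}\in\mathbb{R}^{d_r\times kd_e}$, such that the LowFER scoring function $f$ accurately separates $\mathcal{T}$ from its complement, i.e. for all $e_s,e_o\in\mathcal{E}$ and $r\in\mathcal{R}$, $$f(e_s,r,e_o)=\begin{cases}1,&(e_s,r,e_o)\in\mathcal{T},\\0,&(e_s,r,e_o)\in(\mathcal{E}\times\mathcal{R}\times\mathcal{E})\setminus\mathcal{T}.\end{cases}$$ That is, LowFER is fully expressive with these dimensions and this rank.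
   Context: LowFER model. Given positive integers $d_e,d_r,k$, each entity $e\in\mathcal{E}$ is assigned an embedding vector $\mathbf{e}\in\mathbb{R}^{d_e}$ and each relation $r\in\mathcal{R}$ an embedding vector $\mathbf{r}\in\mathbb{R}^{d_r}$; the shared parameters are matrices $\mathbf{U}\in\mathbb{R}^{d_e\times kd_e}$ and $\mathbf{V}\in\mathbb{R}^{d_r\times kd_e}$. Let $\mathbf{S}^k\in\mathbb{R}^{d_e\times kd_e}$ be the constant matrix with $\mathbf{S}^k_{i,j}=1$ if $(i-1)k+1\le j\le ik$ and $\mathbf{S}^k_{i,j}=0$ otherwise (summation over non-overlapping windows of size $k$). The LowFER scoring function is $$f(e_s,r,e_o)=\bigl(\mathbf{S}^k\,\mathrm{diag}(\mathbf{U}^T\mathbf{e}_s)\,\mathbf{V}^T\mathbf{r}\bigr)^T\mathbf{e}_o .$$ Full expressiveness. A model with scoring function $f$ is fully expressive if, for any set of correct triples $\mathcal{T}\subseteq\mathcal{E}\times\mathcal{R}\times\mathcal{E}$ with incorrect triples $\mathcal{T}'=(\mathcal{E}\times\mathcal{R}\times\mathcal{E})\setminus\mathcal{T}$, it can accurately separate $\mathcal{T}$ from $\mathcal{T}'$; this means perfect reconstruction of the binary tensor of the ground truth, i.e. score $1$ on $\mathcal{T}$ and score $0$ on $\mathcal{T}'$. *)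

theory Defs
  imports "Jordan_Normal_Form.Matrix" "HOL-Library.FuncSet"
begin

(* Rows and columns are indexed from 0, so row i is supported on the columns
   i*k, ..., (i+1)*k - 1. *)
definition window_sum_mat :: "nat \<Rightarrow> nat \<Rightarrow> real mat" where
  "window_sum_mat k d =
     mat d (k * d) (\<lambda>(i, j). if i * k \<le> j \<and> j < (i + 1) * k then 1 else 0)"

definition diag_of_vec :: "'a :: zero vec \<Rightarrow> 'a mat" where
  "diag_of_vec v = mat_diag (dim_vec v) (\<lambda>i. v $ i)"

definition lowfer_score ::
    "nat \<Rightarrow> nat \<Rightarrow> real mat \<Rightarrow> real mat \<Rightarrow> real vec \<Rightarrow> real vec \<Rightarrow> real vec \<Rightarrow> real" where
  "lowfer_score d\<^sub>e k U V s r t =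
     (window_sum_mat k d\<^sub>e *\<^sub>v
       (diag_of_vec (transpose_mat U *\<^sub>v s) *\<^sub>v (transpose_mat V *\<^sub>v r))) \<bullet> t"

(* The model with entity dimension de, relation dimension dr and rank k, as the set
   of scoring functions realised by its parameters. Entities and relations are the
   elements of E and R; embeddings of other elements are irrelevant. *)
definition lowfer_model ::
    "'e set \<Rightarrow> 'r set \<Rightarrow> nat \<Rightarrow> nat \<Rightarrow> nat \<Rightarrow> ('e \<Rightarrow> 'r \<Rightarrow> 'e \<Rightarrow> real) set" where
  "lowfer_model E R d\<^sub>e d\<^sub>r k =
     {f. \<exists>ent rel U V.
           ent \<in> E \<rightarrow> carrier_vec d\<^sub>e \<and> rel \<in> R \<rightarrow> carrier_vec d\<^sub>r \<and>
           U \<in> carrier_mat d\<^sub>e (k * d\<^sub>e) \<and> V \<in> carrier_mat d\<^sub>r (k * d\<^sub>e) \<and>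
           f = (\<lambda>s r t. lowfer_score d\<^sub>e k U V (ent s) (rel r) (ent t))}"

definition accurately_separates ::
    "'e set \<Rightarrow> 'r set \<Rightarrow> ('e \<times> 'r \<times> 'e) set \<Rightarrow> ('e \<Rightarrow> 'r \<Rightarrow> 'e \<Rightarrow> real) \<Rightarrow> bool" where
  "accurately_separates E R T f \<longleftrightarrow>
     (\<forall>(s, r, t) \<in> T. f s r t = 1) \<and> (\<forall>(s, r, t) \<in> E \<times> R \<times> E - T. f s r t = 0)"

definition fully_expressive ::
    "'e set \<Rightarrow> 'r set \<Rightarrow> ('e \<Rightarrow> 'r \<Rightarrow> 'e \<Rightarrow> real) set \<Rightarrow> bool" where
  "fully_expressive E R F \<longleftrightarrow> (\<forall>T \<subseteq> E \<times> R \<times> E. \<exists>f \<in> F. accurately_separates E R T f)"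

end

theory Submission
  imports Defs
begin

text \<open>
  With one-hot embeddings the score of \<open>(i, j, l)\<close> is the sum of
  \<open>U (i, c) * V (j, c)\<close> over the \<open>l\<close>-th window of columns \<open>c\<close>. The windows are disjoint, so
  for each object \<open>l\<close> one may choose an independent rank-\<open>k\<close> factorisation of the slice of the
  ground truth at \<open>l\<close>, a \<open>d\<^sub>e \<times> d\<^sub>r\<close> matrix. For \<open>k = min d\<^sub>e d\<^sub>r\<close> such a factorisation is
  trivial: one factor is the identity and the other the slice itself.
\<close>

lemma mat_mult_unit_vec:
  fixes A :: "'a :: semiring_1 mat"
  assumes "A \<in> carrier_mat m n" and "i < n"
  shows "A *\<^sub>v unit_vec n i = col A i"
  using assms by (intro eq_vecI) auto

lemma diag_of_vec_mult_vec:
  fixes v w :: "'a :: semiring_0 vec"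
  assumes "v \<in> carrier_vec n" and "w \<in> carrier_vec n"
  shows "diag_of_vec v *\<^sub>v w = vec n (\<lambda>i. v $ i * w $ i)"
proof (intro eq_vecI)
  fix i assume "i < dim_vec (vec n (\<lambda>i. v $ i * w $ i))"
  then have i: "i < n" by simp
  have "(diag_of_vec v *\<^sub>v w) $ i = (\<Sum>c\<in>{0..<n}. (if i = c then v $ c else 0) * w $ c)"
    using assms i by (auto simp: diag_of_vec_def mat_diag_def scalar_prod_def intro!: sum.cong)
  also have "\<dots> = (\<Sum>c\<in>{0..<n}. if i = c then v $ c * w $ c else 0)"
    by (intro sum.cong) auto
  finally show "(diag_of_vec v *\<^sub>v w) $ i = vec n (\<lambda>i. v $ i * w $ i) $ i"
    using i by simp
qed (use assms in \<open>simp add: diag_of_vec_def mat_diag_def\<close>)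

lemma window_sum_mat_mult_vec:
  assumes "v \<in> carrier_vec (k * d)" and "l < d"
  shows "(window_sum_mat k d *\<^sub>v v) $ l = (\<Sum>q<k. v $ (l * k + q))"
proof -
  \<comment> \<open>As \<open>l < d\<close>, window \<open>l\<close> ends no later than column
    \<open>k * d\<close>, so cutting it down to the existing columns loses nothing.\<close>
  have "(l + 1) * k \<le> d * k"
    using \<open>l < d\<close> by (intro mult_le_mono1) simp
  then have window: "{0..<k * d} \<inter> {c. l * k \<le> c \<and> c < (l + 1) * k} = {l * k..<l * k + k}"
    by (auto simp: algebra_simps)
  have "(window_sum_mat k d *\<^sub>v v) $ l
      = (\<Sum>c\<in>{0..<k * d}. (if l * k \<le> c \<and> c < (l + 1) * k then 1 else 0) * v $ c)"
    using assms by (auto simp: window_sum_mat_def scalar_prod_def intro!: sum.cong)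
  also have "\<dots> = (\<Sum>c\<in>{0..<k * d}. if l * k \<le> c \<and> c < (l + 1) * k then v $ c else 0)"
    by (intro sum.cong) auto
  also have "\<dots> = (\<Sum>c\<in>{l * k..<l * k + k}. v $ c)"
    using window by (simp add: sum.If_cases)
  also have "\<dots> = (\<Sum>q<k. v $ (l * k + q))"
    using sum.shift_bounds_nat_ivl[of "\<lambda>c. v $ c" 0 "l * k" k]
    by (simp add: lessThan_atLeast0 add.commute)
  finally show ?thesis .
qed

lemma window_index_less:
  fixes l k q m :: nat
  assumes "l < m" and "q < k"
  shows "l * k + q < k * m"
proof -
  have "(l + 1) * k \<le> m * k"
    using \<open>l < m\<close> by (intro mult_le_mono1) simp
  with \<open>q < k\<close> show ?thesis by (simp add: algebra_simps)
qed

text \<open>The one-hot subject and relation select row \<open>i\<close> of \<open>U\<close> and row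
  \<open>j\<close> of \<open>V\<close>, the diagonal matrix multiplies these rows entrywise, and the
  one-hot object reads off a single window sum.\<close>

lemma lowfer_score_unit_vec:
  assumes "U \<in> carrier_mat m (k * m)" and "V \<in> carrier_mat n (k * m)"
    and "i < m" and "j < n" and "l < m"
  shows "lowfer_score m k U V (unit_vec m i) (unit_vec n j) (unit_vec m l)
    = (\<Sum>q<k. U $$ (i, l * k + q) * V $$ (j, l * k + q))"
proof -
  have "transpose_mat U *\<^sub>v unit_vec m i = row U i"
    and "transpose_mat V *\<^sub>v unit_vec n j = row V j"
    using assms by (simp_all add: mat_mult_unit_vec[of _ "k * m"])
  moreover have "diag_of_vec (row U i) *\<^sub>v row V j
      = vec (k * m) (\<lambda>c. row U i $ c * row V j $ c)"
    using assms by (intro diag_of_vec_mult_vec) auto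
  moreover have "dim_row (window_sum_mat k m) = m"
    by (simp add: window_sum_mat_def)
  ultimately have "lowfer_score m k U V (unit_vec m i) (unit_vec n j) (unit_vec m l)
      = (window_sum_mat k m *\<^sub>v vec (k * m) (\<lambda>c. row U i $ c * row V j $ c)) $ l"
    using \<open>l < m\<close> by (simp add: lowfer_score_def carrier_vecI)
  also have "\<dots> = (\<Sum>q<k. U $$ (i, l * k + q) * V $$ (j, l * k + q))"
    using assms window_index_less[OF \<open>l < m\<close>] by (subst window_sum_mat_mult_vec) (auto intro!: sum.cong)
  finally show ?thesis .
qed

text \<open>The identity goes on the shorter side of each \<open>m\<close> by \<open>n\<close>
  slice, which makes the inner dimension \<open>min m n\<close>. The index \<open>l\<close> is a
  mere label for the slice, so its type is arbitrary and no bound on it is imposed.\<close>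

lemma min_rank_factorization:
  fixes M :: "nat \<Rightarrow> nat \<Rightarrow> 'b \<Rightarrow> 'a :: semiring_1"
  obtains A B where
    "\<And>i j l. i < m \<Longrightarrow> j < n \<Longrightarrow> (\<Sum>q<min m n. A i l q * B j l q) = M i j l"
proof (cases "m \<le> n")
  case True
  have "(\<Sum>q<min m n. (if q = i then 1 else 0) * M q j l) = M i j l" if "i < m" for i j l
  proof -
    have "(\<Sum>q<min m n. (if q = i then 1 else 0) * M q j l)
        = (\<Sum>q<m. if q = i then M q j l else 0)"
      using True by (intro sum.cong) (auto simp: min_def)
    then show ?thesis using that by simp
  qed
  then show thesis
    by (rule that[where A = "\<lambda>i l q. if q = i then 1 else 0" and B = "\<lambda>j l q. M q j l"])
next
  case False
  have "(\<Sum>q<min m n. M i q l * (if q = j then 1 else 0)) = M i j l" if "j < n" for i j l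
  proof -
    have "(\<Sum>q<min m n. M i q l * (if q = j then 1 else 0))
        = (\<Sum>q<n. if q = j then M i q l else 0)"
      using False by (intro sum.cong) (auto simp: min_def)
    then show ?thesis using that by simp
  qed
  then show thesis
    using that[where A = "\<lambda>i l q. M i q l" and B = "\<lambda>j l q. if q = j then 1 else 0"] by blast
qed

text \<open>The factors of slice \<open>l\<close> are stored in window \<open>l\<close> of the
  columns of \<open>U\<close> and \<open>V\<close>. Since windows do not overlap, all slices fit
  side by side, and any real tensor is attained, not only a binary one.\<close>

lemma lowfer_realises_tensor:
  fixes M :: "nat \<Rightarrow> nat \<Rightarrow> nat \<Rightarrow> real"
  assumes "k = min m n"
  obtains U V where "U \<in> carrier_mat m (k * m)" "V \<in> carrier_mat n (k * m)"
    "\<And>i j l. i < m \<Longrightarrow> j < n \<Longrightarrow> l < m \<Longrightarrow>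
      lowfer_score m k U V (unit_vec m i) (unit_vec n j) (unit_vec m l) = M i j l"
proof -
  obtain A B where AB:
    "\<And>i j l. i < m \<Longrightarrow> j < n \<Longrightarrow> (\<Sum>q<min m n. A i l q * B j l q) = M i j l"
    using min_rank_factorization[of m n M] by blast
  \<comment> \<open>Column \<open>c = l * k + q\<close> with \<open>q < k\<close> encodes the pair
    \<open>(l, q)\<close>; division with remainder by \<open>k\<close> decodes it.\<close>
  define U where "U = mat m (k * m) (\<lambda>(i, c). A i (c div k) (c mod k))"
  define V where "V = mat n (k * m) (\<lambda>(j, c). B j (c div k) (c mod k))"
  have carrier: "U \<in> carrier_mat m (k * m)" "V \<in> carrier_mat n (k * m)"
    by (simp_all add: U_def V_def)
  have "lowfer_score m k U V (unit_vec m i) (unit_vec n j) (unit_vec m l) = M i j l"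
    if "i < m" "j < n" "l < m" for i j l
  proof -
    have "(\<Sum>q<k. U $$ (i, l * k + q) * V $$ (j, l * k + q))
        = (\<Sum>q<k. A i l q * B j l q)"
      using that window_index_less[OF \<open>l < m\<close>] by (intro sum.cong) (auto simp: U_def V_def)
    also have "\<dots> = M i j l"
      using AB that assms by simp
    finally show ?thesis
      by (simp add: lowfer_score_unit_vec[OF carrier that])
  qed
  with carrier show thesis by (rule that)
qed

text \<open>Enumerating \<open>E\<close> and \<open>R\<close> by initial segments of the naturals
  turns the ground truth into a 0/1 tensor, to which the realisation of arbitrary tensors
  applies.\<close>

lemma lowfer_separates:
  fixes E :: "'e set" and R :: "'r set"
  assumes "finite E" and "finite R" and T: "T \<subseteq> E \<times> R \<times> E"
    and "k = min (card E) (card R)"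
  shows "\<exists>ent rel U V.
    ent \<in> E \<rightarrow> carrier_vec (card E) \<and> rel \<in> R \<rightarrow> carrier_vec (card R) \<and>
    U \<in> carrier_mat (card E) (k * card E) \<and> V \<in> carrier_mat (card R) (k * card E) \<and>
    accurately_separates E R T
      (\<lambda>s r t. lowfer_score (card E) k U V (ent s) (rel r) (ent t))"
proof -
  obtain g where g: "bij_betw g E {0..<card E}"
    using \<open>finite E\<close> ex_bij_betw_finite_nat by blast
  obtain h where h: "bij_betw h R {0..<card R}"
    using \<open>finite R\<close> ex_bij_betw_finite_nat by blast
  obtain U V where UV: "U \<in> carrier_mat (card E) (k * card E)"
      "V \<in> carrier_mat (card R) (k * card E)"
    \<comment> \<open>The tensor is indexed by numbers, so membership in \<open>T\<close> is tested
      after decoding them with the inverse enumerations; on \<open>g s\<close>, \<open>h r\<close>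
      and \<open>g t\<close> these give back \<open>s\<close>, \<open>r\<close> and
      \<open>t\<close>.\<close>
    and score: "\<And>i j l. i < card E \<Longrightarrow> j < card R \<Longrightarrow> l < card E \<Longrightarrow>
      lowfer_score (card E) k U V (unit_vec (card E) i) (unit_vec (card R) j)
          (unit_vec (card E) l) = of_bool ((inv_into E g i, inv_into R h j, inv_into E g l) \<in> T)"
    using lowfer_realises_tensor[OF \<open>k = min (card E) (card R)\<close>,
        where M = "\<lambda>i j l. of_bool ((inv_into E g i, inv_into R h j, inv_into E g l) \<in> T)"]
    by blast
  let ?ent = "\<lambda>s. unit_vec (card E) (g s) :: real vec"
  let ?rel = "\<lambda>r. unit_vec (card R) (h r) :: real vec"
  have "lowfer_score (card E) k U V (?ent s) (?rel r) (?ent t) = of_bool ((s, r, t) \<in> T)"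
    if "s \<in> E" "r \<in> R" "t \<in> E" for s r t
  proof -
    have "g s < card E" "h r < card R" "g t < card E"
      using that bij_betwE[OF g] bij_betwE[OF h] by auto
    with score that show ?thesis
      using bij_betw_inv_into_left[OF g] bij_betw_inv_into_left[OF h] by simp
  qed
  \<comment> \<open>The scores are known on \<open>E \<times> R \<times> E\<close> only; the
    inclusion \<open>T\<close> puts every correct triple there.\<close>
  with T have "accurately_separates E R T
      (\<lambda>s r t. lowfer_score (card E) k U V (?ent s) (?rel r) (?ent t))"
    unfolding accurately_separates_def by auto
  moreover have "?ent \<in> E \<rightarrow> carrier_vec (card E)" "?rel \<in> R \<rightarrow> carrier_vec (card R)"
    by auto
  ultimately show ?thesis using UV by blast
qed

theorem proposition1:
  fixes E :: "'e set" and R :: "'r set" and T :: "('e \<times> 'r \<times> 'e) set"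
    and d\<^sub>e d\<^sub>r k :: nat
  assumes "finite E" and "E \<noteq> {}" and "finite R" and "R \<noteq> {}"
    and "T \<subseteq> E \<times> R \<times> E"
    and "d\<^sub>e = card E" and "d\<^sub>r = card R" and "k = min d\<^sub>e d\<^sub>r"
  shows "(\<exists>(ent :: 'e \<Rightarrow> real vec) (rel :: 'r \<Rightarrow> real vec) (U :: real mat) (V :: real mat).
            ent \<in> E \<rightarrow> carrier_vec d\<^sub>e \<and> rel \<in> R \<rightarrow> carrier_vec d\<^sub>r \<and>
            U \<in> carrier_mat d\<^sub>e (k * d\<^sub>e) \<and> V \<in> carrier_mat d\<^sub>r (k * d\<^sub>e) \<and>
            accurately_separates E R T
              (\<lambda>s r t. lowfer_score d\<^sub>e k U V (ent s) (rel r) (ent t)))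
         \<and> fully_expressive E R (lowfer_model E R d\<^sub>e d\<^sub>r k)"
proof
  \<comment> \<open>Stated for an arbitrary ground truth \<open>T'\<close>, so that it yields both
    the claim for the given \<open>T\<close> and full expressiveness, which quantifies over all
    ground truths at fixed dimensions and rank.\<close>
  have separates: "\<exists>ent rel U V.
      ent \<in> E \<rightarrow> carrier_vec d\<^sub>e \<and> rel \<in> R \<rightarrow> carrier_vec d\<^sub>r \<and>
      U \<in> carrier_mat d\<^sub>e (k * d\<^sub>e) \<and> V \<in> carrier_mat d\<^sub>r (k * d\<^sub>e) \<and>
      accurately_separates E R T'
        (\<lambda>s r t. lowfer_score d\<^sub>e k U V (ent s) (rel r) (ent t))"
    if "T' \<subseteq> E \<times> R \<times> E" for T'
    using lowfer_separates[of E R T' k] that assms by simp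
  show "\<exists>ent rel U V.
      ent \<in> E \<rightarrow> carrier_vec d\<^sub>e \<and> rel \<in> R \<rightarrow> carrier_vec d\<^sub>r \<and>
      U \<in> carrier_mat d\<^sub>e (k * d\<^sub>e) \<and> V \<in> carrier_mat d\<^sub>r (k * d\<^sub>e) \<and>
      accurately_separates E R T
        (\<lambda>s r t. lowfer_score d\<^sub>e k U V (ent s) (rel r) (ent t))"
    using separates[OF \<open>T \<subseteq> E \<times> R \<times> E\<close>] .
  show "fully_expressive E R (lowfer_model E R d\<^sub>e d\<^sub>r k)"
    unfolding fully_expressive_def
  proof (intro allI impI)
    fix T' assume "T' \<subseteq> E \<times> R \<times> E"
    from separates[OF this] obtain ent rel U V where
      params: "ent \<in> E \<rightarrow> carrier_vec d\<^sub>e" "rel \<in> R \<rightarrow> carrier_vec d\<^sub>r"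
        "U \<in> carrier_mat d\<^sub>e (k * d\<^sub>e)" "V \<in> carrier_mat d\<^sub>r (k * d\<^sub>e)"
      and sep: "accurately_separates E R T'
        (\<lambda>s r t. lowfer_score d\<^sub>e k U V (ent s) (rel r) (ent t))"
      by (elim exE conjE)
    have "(\<lambda>s r t. lowfer_score d\<^sub>e k U V (ent s) (rel r) (ent t)) \<in> lowfer_model E R d\<^sub>e d\<^sub>r k"
      unfolding lowfer_model_def by (intro CollectI exI conjI) (rule params refl)+
    with sep show "\<exists>f \<in> lowfer_model E R d\<^sub>e d\<^sub>r k. accurately_separates E R T' f"
      by (rule bexI)
  qed
qed

end
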